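(* Let $\pi(\theta\mid y)\propto \pi(\theta)\prod_{i=1}^n\pi(y_i\mid\theta)$ be the target posterior on $\Theta$ and $\pi(\omega,\theta\mid y)\propto\pi(\theta)\prod_{i=1}^n\pi(y_i,\omega_i\mid\theta)$ the augmented posterior on $\Omega^n\times\Theta$, where $\omega=(\omega_1,\dots,\omega_n)\in\Omega^n$ and $\pi(y_i\mid\theta)=\int_\Omega\pi(y_i,\omega_i\mid\theta)\,d\omega_i$ for each $i$. Let $\mathcal Q_M$ be a family of densities $q(\theta)$ on $\Theta$, let $\mathcal Q_C$ be a family of conditional densities $q(\omega\mid\theta)$ on $\Omega^n$ given $\theta$, and let $$\mathcal Q_A=\{q(\omega,\theta)=q(\theta)\,q(\omega\mid\theta):\ q(\theta)\in\mathcal Q_M,\ q(\omega\mid\theta)\in\mathcal Q_C\}.$$ Let $q_M^*(\theta)\in\mathcal Q_M$ be a minimizer of $\mathrm{KL}\{q(\theta)\,\|\,\pi(\theta\mid y)\}$ over $q\in\mathcal Q_M$, and let $q_A^*(\omega,\theta)=q_A^*(\theta)\,q_A^*(\omega\mid\theta)\in\mathcal Q_A$ be a minimizer of $\mathrm{KL}\{q(\omega,\theta)\,\|\,\pi(\omega,\theta\mid y)\}$ over $q\in\mathcal Q_A$. Then $$\mathrm{KL}\{q_M^*(\theta)\,\|\,\pi(\theta\mid y)\}\ \le\ \mathrm{KL}\{q_A^*(\theta)\,\|\,\pi(\theta\mid y)\}\ \le\ \mathrm{KL}\{q_A^*(\omega,\theta)\,\|\,\pi(\omega,\theta\mid y)\}.$$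 Moreover, if $\pi(\omega\mid\theta,y)\in\mathcal Q_C$, then $q_A^*(\omega\mid\theta)=\pi(\omega\mid\theta,y)$ and $q_A^*(\theta)=q_M^*(\theta)$ almost everywhere, and $$\mathrm{KL}\{q_M^*(\theta)\,\|\,\pi(\theta\mid y)\}=\mathrm{KL}\{q_A^*(\theta)\,\|\,\pi(\theta\mid y)\}=\mathrm{KL}\{q_A^*(\omega,\theta)\,\|\,\pi(\omega,\theta\mid y)\}.$$
   Context: $\mathrm{KL}\{q\,\|\,\pi\}=\int q\log(q/\pi)$ is the Kullback–Leibler divergence. For $q(\omega,\theta)\in\mathcal Q_A$, $q(\theta)$ denotes the $\theta$-marginal and $q(\omega\mid\theta)$ the conditional density of $\omega$ given $\theta$; likewise $\pi(\omega\mid\theta,y)$ is the conditional density of $\omega$ given $\theta$ under the augmented posterior $\pi(\omega,\theta\mid y)$, whose $\theta$-marginal is $\pi(\theta\mid y)$. The data $y=(y_1,\dots,y_n)$ are fixed.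
   Formalization: The equality of conditionals is claimed where q_A^*(θ)>0 and only if KL{q_M^*||π(θ|y)} is finite; q_A^*(θ)=q_M^*(θ) a.e. is claimed only if q_M^* is the a.e.-unique minimizer over Q_M. Without these guards the claims fail (e.g. two minimizers of equal KL). *)

theory Defs
  imports "HOL-Probability.Probability"
begin

definition prob_density :: "'a measure \<Rightarrow> ('a \<Rightarrow> real) \<Rightarrow> bool" where
  "prob_density M q \<longleftrightarrow>
     q \<in> borel_measurable M \<and> (\<forall>x\<in>space M. 0 \<le> q x) \<and> prob_space (density M q)"

text \<open>\<open>c w t\<close> is read \<open>q(w | t)\<close>: jointly measurable, and a probability density in \<open>w\<close>
  for every \<open>t\<close>.\<close>

definition cond_prob_density ::
    "'w measure \<Rightarrow> 't measure \<Rightarrow> ('w \<Rightarrow> 't \<Rightarrow> real) \<Rightarrow> bool" where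
  "cond_prob_density W T c \<longleftrightarrow>
     (\<lambda>(w, t). c w t) \<in> borel_measurable (W \<Otimes>\<^sub>M T) \<and>
     (\<forall>t\<in>space T. prob_density W (\<lambda>w. c w t))"

text \<open>The Kullback--Leibler divergence \<open>\<integral> q log (q / p)\<close> with values in the extended reals. For
  probability densities the negative part of \<open>q log (q / p)\<close> is always integrable
  (\<open>q log (q / p) \<ge> q - p\<close>), so a non-integrable integrand means that the divergence is \<open>\<infinity>\<close>;
  so does \<open>q > 0 = p\<close> on a set of positive measure. The library's real-valued
  \<^const>\<open>KL_divergence\<close> would return a junk value there, and minimization would then be
  meaningless; in the finite case the two agree, see \<open>kl_eq_KL_divergence\<close>.\<close>

definition kl :: "'a measure \<Rightarrow> ('a \<Rightarrow> real) \<Rightarrow> ('a \<Rightarrow> real) \<Rightarrow> ereal" where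
  "kl M q p =
     (if (AE x in M. p x = 0 \<longrightarrow> q x = 0) \<and> integrable M (\<lambda>x. q x * ln (q x / p x))
      then ereal (LINT x|M. q x * ln (q x / p x)) else \<infinity>)"

lemma kl_eq_KL_divergence:
  assumes "sigma_finite_measure M" and q: "prob_density M q" and p: "prob_density M p"
    and fin: "kl M q p < \<infinity>"
  shows "kl M q p = ereal (KL_divergence (exp 1) (density M p) (density M q))"
proof -
  interpret sigma_finite_measure M by fact
  have ac: "AE x in M. p x = 0 \<longrightarrow> q x = 0"
    using fin by (auto simp: kl_def split: if_splits)
  have "KL_divergence (exp 1) (density M p) (density M q)
      = (LINT x|M. q x * log (exp 1) (q x / p x))"
    using q p ac by (intro KL_density_density) (auto simp: prob_density_def)
  then show ?thesis
    using fin by (auto simp: kl_def log_def split: if_splits)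
qed

text \<open>The density proportional to \<open>f\<close>.\<close>

definition normalized :: "'a measure \<Rightarrow> ('a \<Rightarrow> real) \<Rightarrow> 'a \<Rightarrow> real" where
  "normalized M f = (\<lambda>x. f x / (LINT z|M. f z))"

definition posterior ::
    "'t measure \<Rightarrow> nat \<Rightarrow> ('t \<Rightarrow> real) \<Rightarrow> (nat \<Rightarrow> 'y \<Rightarrow> 't \<Rightarrow> real) \<Rightarrow> (nat \<Rightarrow> 'y) \<Rightarrow> 't \<Rightarrow> real" where
  "posterior T n prior lik y =
     normalized T (\<lambda>t. prior t * (\<Prod>i=1..n. lik i (y i) t))"

abbreviation latent_space :: "nat \<Rightarrow> 'w measure \<Rightarrow> (nat \<Rightarrow> 'w) measure" where
  "latent_space n W \<equiv> Pi\<^sub>M {1..n} (\<lambda>_. W)"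

definition aug_posterior ::
    "'t measure \<Rightarrow> 'w measure \<Rightarrow> nat \<Rightarrow> ('t \<Rightarrow> real) \<Rightarrow> (nat \<Rightarrow> 'y \<Rightarrow> 'w \<Rightarrow> 't \<Rightarrow> real) \<Rightarrow> (nat \<Rightarrow> 'y)
      \<Rightarrow> (nat \<Rightarrow> 'w) \<times> 't \<Rightarrow> real" where
  "aug_posterior T W n prior clik y =
     normalized (latent_space n W \<Otimes>\<^sub>M T)
       (\<lambda>(w, t). prior t * (\<Prod>i=1..n. clik i (y i) (w i) t))"

definition marginal :: "'w measure \<Rightarrow> ('w \<times> 't \<Rightarrow> real) \<Rightarrow> 't \<Rightarrow> real" where
  "marginal W f t = (LINT w|W. f (w, t))"

text \<open>\<open>c\<close> is a version of the conditional density of \<open>w\<close> given \<open>t\<close> under the joint density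
  \<open>f\<close>. The quotient determines it only where the marginal is positive; elsewhere \<open>c\<close> may be any
  conditional density.\<close>

definition is_conditional_of ::
    "'w measure \<Rightarrow> 't measure \<Rightarrow> ('w \<times> 't \<Rightarrow> real) \<Rightarrow> ('w \<Rightarrow> 't \<Rightarrow> real) \<Rightarrow> bool" where
  "is_conditional_of W T f c \<longleftrightarrow>
     cond_prob_density W T c \<and>
     (AE (w, t) in W \<Otimes>\<^sub>M T. 0 < marginal W f t \<longrightarrow> c w t = f (w, t) / marginal W f t)"

definition joint :: "('t \<Rightarrow> real) \<Rightarrow> ('w \<Rightarrow> 't \<Rightarrow> real) \<Rightarrow> 'w \<times> 't \<Rightarrow> real" where
  "joint q c = (\<lambda>(w, t). q t * c w t)"

definition aug_family ::
    "('t \<Rightarrow> real) set \<Rightarrow> ('w \<Rightarrow> 't \<Rightarrow> real) set \<Rightarrow> ('w \<times> 't \<Rightarrow> real) set" where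
  "aug_family QM QC = {joint q c | q c. q \<in> QM \<and> c \<in> QC}"

abbreviation is_kl_minimizer ::
    "'a measure \<Rightarrow> ('a \<Rightarrow> real) set \<Rightarrow> ('a \<Rightarrow> real) \<Rightarrow> ('a \<Rightarrow> real) \<Rightarrow> bool" where
  "is_kl_minimizer M Q p q \<equiv> is_arg_min (\<lambda>q. kl M q p) (\<lambda>q. q \<in> Q) q"

end

theory Submission imports Defs begin

text \<open>Let \<open>m\<close> be the \<open>\<theta>\<close>-marginal of the joint density \<open>p\<close>, and \<open>q(\<theta>) c(\<omega> | \<theta>)\<close> a competitor. By
  \<open>ln r \<le> r - 1\<close> at \<open>r = p / (c m)\<close>, the defect \<open>q c ln (q c / p) - q c ln (q / m) - q c + q p / m\<close> is
  nonnegative, and it vanishes where \<open>q > 0\<close> only if \<open>c = p / m\<close>. The last two terms integrate to \<open>-1\<close>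
  and \<open>1\<close>, so the defect integrates to the joint divergence minus the marginal one. Working with
  the defect on the product space avoids divergences of the conditionals at fixed \<open>\<theta>\<close>, and the
  same pointwise bound dominates \<open>q c ln (q / m)\<close>, so that finiteness of the joint divergence
  passes to the marginal one. When the exact conditional is available, the competitor
  \<open>q\<^sub>M(\<theta>) \<pi>(\<omega> | \<theta>, y)\<close> has joint divergence equal to the optimal marginal one, which forces the chain
  of inequalities to collapse.\<close>

section \<open>Probability densities and normalization\<close>

lemma prob_density_iff_nn_integral:
  "prob_density M q \<longleftrightarrow>
     q \<in> borel_measurable M \<and> (\<forall>x\<in>space M. 0 \<le> q x) \<and> (\<integral>\<^sup>+x. ennreal (q x) \<partial>M) = 1"
proof -
  have "emeasure (density M (\<lambda>x. ennreal (q x))) (space M) = (\<integral>\<^sup>+x. ennreal (q x) \<partial>M)"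
    if "q \<in> borel_measurable M"
    using that by (subst emeasure_density) (auto intro!: nn_integral_cong simp: indicator_def)
  then show ?thesis
    using prob_space.emeasure_space_1[of "density M (\<lambda>x. ennreal (q x))"]
      prob_spaceI[of "density M (\<lambda>x. ennreal (q x))"]
    by (auto simp: prob_density_def)
qed

lemma prob_density_has_integral:
  assumes "prob_density M q"
  shows "integrable M q" and "(LINT x|M. q x) = 1"
proof -
  have q: "q \<in> borel_measurable M" "AE x in M. 0 \<le> q x" "(\<integral>\<^sup>+x. ennreal (q x) \<partial>M) = 1"
    using assms by (auto simp: prob_density_iff_nn_integral)
  then show "integrable M q"
    by (intro integrableI_nonneg) auto
  show "(LINT x|M. q x) = 1"
    using q by (simp add: integral_eq_nn_integral)
qed

lemma prob_density_normalized:
  assumes f: "integrable M f" "\<And>x. x \<in> space M \<Longrightarrow> 0 \<le> f x" and pos: "0 < (LINT x|M. f x)"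
  shows "prob_density M (normalized M f)"
proof -
  have [measurable]: "f \<in> borel_measurable M"
    using f by auto
  have nonneg: "\<forall>x\<in>space M. 0 \<le> normalized M f x"
    using f(2) pos by (simp add: normalized_def)
  have "(\<integral>\<^sup>+x. ennreal (normalized M f x) \<partial>M) = ennreal (LINT x|M. normalized M f x)"
    using f nonneg by (intro nn_integral_eq_integral) (auto simp: normalized_def)
  then show ?thesis
    using nonneg pos f(1) by (simp add: prob_density_iff_nn_integral normalized_def)
qed

section \<open>Integrals over the product space against a density with known marginal\<close>

text \<open>Tonelli with the first coordinate integrated first: \<open>u\<close> is constant there
  and comes out. With values in \<open>ennreal\<close> this can be used before any integrability is
  known.\<close>

lemma (in pair_sigma_finite) nn_integral_times_marginal:
  fixes f :: "'a \<times> 'b \<Rightarrow> real" and m :: "'b \<Rightarrow> real" and u :: "'b \<Rightarrow> ennreal"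
  assumes [measurable]: "f \<in> borel_measurable (M1 \<Otimes>\<^sub>M M2)" "u \<in> borel_measurable M2"
    and m: "\<And>t. t \<in> space M2 \<Longrightarrow> (\<integral>\<^sup>+w. ennreal (f (w, t)) \<partial>M1) = ennreal (m t)"
  shows "(\<integral>\<^sup>+z. u (snd z) * ennreal (f z) \<partial>(M1 \<Otimes>\<^sub>M M2)) = (\<integral>\<^sup>+t. u t * ennreal (m t) \<partial>M2)"
proof -
  have "(\<integral>\<^sup>+z. u (snd z) * ennreal (f z) \<partial>(M1 \<Otimes>\<^sub>M M2)) =
      (\<integral>\<^sup>+t. (\<integral>\<^sup>+w. u t * ennreal (f (w, t)) \<partial>M1) \<partial>M2)"
    by (subst nn_integral_snd[symmetric]) auto
  also have "\<dots> = (\<integral>\<^sup>+t. u t * ennreal (m t) \<partial>M2)"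
    by (intro nn_integral_cong) (simp add: nn_integral_cmult m)
  finally show ?thesis .
qed

text \<open>Since \<open>f\<close> and \<open>m\<close> are nonnegative, the unsigned version
  applied to the absolute value of \<open>u\<close> compares the two norms; Fubini then gives the
  value. Here \<open>u\<close> may change sign, as a log ratio does.\<close>

lemma (in pair_sigma_finite)
  fixes f :: "'a \<times> 'b \<Rightarrow> real" and m u :: "'b \<Rightarrow> real"
  assumes [measurable]: "f \<in> borel_measurable (M1 \<Otimes>\<^sub>M M2)" "u \<in> borel_measurable M2"
      "m \<in> borel_measurable M2"
    and f_nonneg: "\<And>z. z \<in> space (M1 \<Otimes>\<^sub>M M2) \<Longrightarrow> 0 \<le> f z"
    and m_nonneg: "\<And>t. t \<in> space M2 \<Longrightarrow> 0 \<le> m t"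
    and m: "\<And>t. t \<in> space M2 \<Longrightarrow> (\<integral>\<^sup>+w. ennreal (f (w, t)) \<partial>M1) = ennreal (m t)"
  shows integrable_times_marginal_iff:
      "integrable (M1 \<Otimes>\<^sub>M M2) (\<lambda>z. u (snd z) * f z) \<longleftrightarrow> integrable M2 (\<lambda>t. u t * m t)"
    and integral_times_marginal:
      "integrable M2 (\<lambda>t. u t * m t) \<Longrightarrow>
        (LINT z|(M1 \<Otimes>\<^sub>M M2). u (snd z) * f z) = (LINT t|M2. u t * m t)"
proof -
  have "(\<integral>\<^sup>+z. ennreal (norm (u (snd z) * f z)) \<partial>(M1 \<Otimes>\<^sub>M M2)) =
      (\<integral>\<^sup>+z. ennreal \<bar>u (snd z)\<bar> * ennreal (f z) \<partial>(M1 \<Otimes>\<^sub>M M2))"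
    by (intro nn_integral_cong) (simp add: f_nonneg abs_mult ennreal_mult)
  also have "\<dots> = (\<integral>\<^sup>+t. ennreal \<bar>u t\<bar> * ennreal (m t) \<partial>M2)"
    by (intro nn_integral_times_marginal m) auto
  also have "\<dots> = (\<integral>\<^sup>+t. ennreal (norm (u t * m t)) \<partial>M2)"
    by (intro nn_integral_cong) (simp add: m_nonneg abs_mult ennreal_mult)
  finally show iff: "integrable (M1 \<Otimes>\<^sub>M M2) (\<lambda>z. u (snd z) * f z) \<longleftrightarrow> integrable M2 (\<lambda>t. u t * m t)"
    by (simp add: integrable_iff_bounded)
  have inner: "(LINT w|M1. f (w, t)) = m t" if t: "t \<in> space M2" for t
    using t by (subst integral_eq_nn_integral)
      (auto simp: m m_nonneg space_pair_measure intro!: AE_I2 f_nonneg)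
  assume "integrable M2 (\<lambda>t. u t * m t)"
  then have "integrable (M1 \<Otimes>\<^sub>M M2) (case_prod (\<lambda>w t. u t * f (w, t)))"
    using iff by (simp add: case_prod_unfold)
  from integral_snd[OF this] show "(LINT z|(M1 \<Otimes>\<^sub>M M2). u (snd z) * f z) = (LINT t|M2. u t * m t)"
    by (simp add: case_prod_unfold inner cong: Bochner_Integration.integral_cong)
qed

text \<open>The cylinder over a null set is null even if \<open>M1\<close> has infinite mass,
  because a product with \<open>0\<close> is \<open>0\<close> in \<open>ennreal\<close>.\<close>

lemma (in pair_sigma_finite) AE_pair_sndI:
  assumes "AE t in M2. P t"
  shows "AE z in M1 \<Otimes>\<^sub>M M2. P (snd z)"
proof -
  obtain N where N: "{t\<in>space M2. \<not> P t} \<subseteq> N" "N \<in> null_sets M2"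
    using assms by (auto simp: eventually_ae_filter)
  have "space M1 \<times> N \<in> null_sets (M1 \<Otimes>\<^sub>M M2)"
    using N(2) by (auto simp: null_sets_def M2.emeasure_pair_measure_Times)
  with N(1) show ?thesis
    by (auto simp: space_pair_measure intro!: AE_I')
qed

section \<open>The pointwise inequality behind the chain rule\<close>

text \<open>For positive arguments and \<open>r = p / (c * m)\<close>, \<open>D\<close> equals
  \<open>q * c * (r - 1 - ln r)\<close>, which is nonnegative and vanishes only at
  \<open>r = 1\<close>. The two implications are the pointwise forms of absolute continuity.\<close>

lemma kl_chain_defect_nonneg:
  fixes q c p m :: real
  assumes "0 \<le> q" "0 \<le> c" "0 \<le> p" "0 \<le> m" "m = 0 \<longrightarrow> q = 0" "p = 0 \<longrightarrow> q * c = 0"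
  defines "D \<equiv> q * c * ln (q * c / p) - q * c * ln (q / m) - q * c + q / m * p"
  shows "0 \<le> D" and "D = 0 \<Longrightarrow> 0 < q \<Longrightarrow> c = p / m"
proof -
  have "0 \<le> D \<and> (D = 0 \<longrightarrow> 0 < q \<longrightarrow> c = p / m)"
  proof (cases "q * c = 0")
    \<comment> \<open>Only \<open>q / m * p\<close> survives. If it is \<open>0\<close> with
      \<open>q > 0\<close>, then \<open>m > 0\<close>, hence \<open>p = 0\<close>, and also
      \<open>c = 0\<close>, so \<open>c = p / m\<close> holds with both sides
      \<open>0\<close>.\<close>
    case True
    then show ?thesis using assms by (auto simp: D_def)
  next
    case False
    then have pos: "0 < q" "0 < c" "0 < m" "0 < p"
      using assms by (auto simp: less_le)
    define r where "r = p / (c * m)"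
    have r: "0 < r" using pos by (simp add: r_def)
    have "ln (q * c / p) - ln (q / m) = - ln r"
      using pos by (simp add: r_def ln_div ln_mult)
    moreover have "q / m * p = q * c * r"
      using pos by (simp add: r_def field_simps)
    ultimately have D: "D = q * c * (r - 1 - ln r)"
      by (simp add: D_def algebra_simps) (metis (no_types) add.commute diff_add_cancel distrib_left mult.commute)
    have "0 \<le> D"
      using pos ln_le_minus_one[OF r] by (simp add: D)
    moreover have "c = p / m" if "D = 0"
    proof -
      have "r = 1" using that pos ln_eq_minus_one[OF r] by (simp add: D)
      then show ?thesis using pos by (simp add: r_def field_simps)
    qed
    ultimately show ?thesis by simp
  qed
  then show "0 \<le> D" and "D = 0 \<Longrightarrow> 0 < q \<Longrightarrow> c = p / m" by auto
qed

section \<open>Joint divergence versus marginal divergence\<close>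

text \<open>The pair \<open>q\<close>, \<open>c\<close> is an arbitrary competitor, so the results
  apply both to the joint minimizer and to the pair formed from the marginal minimizer and the exact
  conditional.\<close>

locale kl_disintegration = pair_sigma_finite W T
  for W :: "'w measure" and T :: "'t measure" +
  fixes p :: "'w \<times> 't \<Rightarrow> real" and m q :: "'t \<Rightarrow> real" and c :: "'w \<Rightarrow> 't \<Rightarrow> real"
  assumes p_measurable [measurable]: "p \<in> borel_measurable (W \<Otimes>\<^sub>M T)"
    and p_nonneg: "\<And>z. z \<in> space (W \<Otimes>\<^sub>M T) \<Longrightarrow> 0 \<le> p z"
    and m: "prob_density T m"
    and marginal_p: "\<And>t. t \<in> space T \<Longrightarrow> (\<integral>\<^sup>+w. ennreal (p (w, t)) \<partial>W) = ennreal (m t)"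
    and q: "prob_density T q"
    and c: "cond_prob_density W T c"
begin

abbreviation cc :: "'w \<times> 't \<Rightarrow> real" where "cc z \<equiv> c (fst z) (snd z)"

lemma m_measurable [measurable]: "m \<in> borel_measurable T"
  and m_nonneg: "t \<in> space T \<Longrightarrow> 0 \<le> m t"
  and q_measurable [measurable]: "q \<in> borel_measurable T"
  and q_nonneg: "t \<in> space T \<Longrightarrow> 0 \<le> q t"
  using m q by (auto simp: prob_density_def)

lemma c_measurable [measurable]: "cc \<in> borel_measurable (W \<Otimes>\<^sub>M T)"
  using c by (simp add: cond_prob_density_def case_prod_unfold)

lemma c_nonneg: "z \<in> space (W \<Otimes>\<^sub>M T) \<Longrightarrow> 0 \<le> cc z"
  and marginal_c: "t \<in> space T \<Longrightarrow> (\<integral>\<^sup>+w. ennreal (cc (w, t)) \<partial>W) = ennreal 1"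
  using c by (auto simp: cond_prob_density_def prob_density_iff_nn_integral space_pair_measure)

text \<open>Premise lists for the two marginal lemmas, with \<open>f\<close> the conditional density
  (marginal constantly \<open>1\<close>) or \<open>p\<close> (marginal \<open>m\<close>). The gaps
  are measurability of \<open>u\<close> and, for the constant \<open>1\<close>, its trivial side
  conditions.\<close>

lemmas times_c = c_measurable _ _ c_nonneg _ marginal_c
lemmas times_p = p_measurable _ m_measurable p_nonneg m_nonneg marginal_p

lemma AE_nonneg:
  "AE z in W \<Otimes>\<^sub>M T. 0 \<le> q (snd z) \<and> 0 \<le> cc z \<and> 0 \<le> p z \<and> 0 \<le> m (snd z)"
  by (intro AE_I2)
    (auto simp: q_nonneg m_nonneg p_nonneg space_pair_measure intro!: c_nonneg[simplified])

text \<open>Over the set where \<open>m\<close> vanishes, \<open>p\<close> has total mass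
  \<open>0\<close>, so \<open>p\<close> and hence \<open>q * c\<close> vanish almost everywhere
  there. Integrating out \<open>c\<close>, which has mass \<open>1\<close> for each
  \<open>t\<close>, leaves \<open>q = 0\<close> on that set; \<open>u\<close> is its
  indicator.\<close>

lemma AE_marginal_zero_imp:
  assumes "AE z in W \<Otimes>\<^sub>M T. p z = 0 \<longrightarrow> q (snd z) * cc z = 0"
  shows "AE t in T. m t = 0 \<longrightarrow> q t = 0"
proof -
  define u where "u t = (if m t = 0 then 1 else 0 :: ennreal)" for t
  have [measurable]: "u \<in> borel_measurable T"
    unfolding u_def by measurable
  have "(\<integral>\<^sup>+z. u (snd z) * ennreal (p z) \<partial>(W \<Otimes>\<^sub>M T)) = (\<integral>\<^sup>+t. u t * ennreal (m t) \<partial>T)"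
    by (intro nn_integral_times_marginal marginal_p) auto
  also have "\<dots> = (\<integral>\<^sup>+t. 0 \<partial>T)"
    by (intro nn_integral_cong) (simp add: u_def)
  finally have "AE z in W \<Otimes>\<^sub>M T. u (snd z) * ennreal (p z) = 0"
    by (subst nn_integral_0_iff_AE[symmetric]) auto
  then have "AE z in W \<Otimes>\<^sub>M T. u (snd z) * ennreal (q (snd z)) * ennreal (cc z) = 0"
    using assms AE_nonneg
    by eventually_elim (auto simp: u_def ennreal_eq_0_iff split: if_splits)
  then have "(\<integral>\<^sup>+z. u (snd z) * ennreal (q (snd z)) * ennreal (cc z) \<partial>(W \<Otimes>\<^sub>M T)) = 0"
    by (subst nn_integral_0_iff_AE) auto
  moreover have "(\<integral>\<^sup>+z. u (snd z) * ennreal (q (snd z)) * ennreal (cc z) \<partial>(W \<Otimes>\<^sub>M T)) =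
      (\<integral>\<^sup>+t. u t * ennreal (q t) * ennreal 1 \<partial>T)"
    by (intro nn_integral_times_marginal[where u = "\<lambda>t. u t * ennreal (q t)"] marginal_c) auto
  ultimately have "AE t in T. u t * ennreal (q t) = 0"
    by (simp add: nn_integral_0_iff_AE)
  then show ?thesis
    using AE_space
    by eventually_elim (use q_nonneg in \<open>force simp: u_def ennreal_eq_0_iff split: if_splits\<close>)
qed

text \<open>Where all factors are positive, the two logarithmic terms combine to
  \<open>q * c * ln (c / (p / m))\<close>, the integrand of the \<open>q\<close>-averaged divergence
  of \<open>c\<close> from the exact conditional. The other two terms make it nonnegative
  pointwise.\<close>

definition defect :: "'w \<times> 't \<Rightarrow> real" where
  "defect z = q (snd z) * cc z * ln (q (snd z) * cc z / p z)
     - q (snd z) * cc z * ln (q (snd z) / m (snd z)) - q (snd z) * cc z + q (snd z) / m (snd z) * p z"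

text \<open>Chain rule for the divergence. Finiteness makes the joint integrand integrable, and
  every other term of the defect is then shown integrable too, so that the integral may be
  split.\<close>

lemma kl_joint_decomposition:
  assumes fin: "kl (W \<Otimes>\<^sub>M T) (joint q c) p < \<infinity>"
  shows "integrable (W \<Otimes>\<^sub>M T) defect"
    and "AE z in W \<Otimes>\<^sub>M T. 0 \<le> defect z"
    and "AE z in W \<Otimes>\<^sub>M T. defect z = 0 \<longrightarrow> 0 < q (snd z) \<longrightarrow> cc z = p z / m (snd z)"
    and "kl (W \<Otimes>\<^sub>M T) (joint q c) p = kl T q m + ereal (LINT z|(W \<Otimes>\<^sub>M T). defect z)"
proof -
  let ?A = "\<lambda>z. q (snd z) * cc z * ln (q (snd z) * cc z / p z)"
  let ?u = "\<lambda>t. q t * ln (q t / m t)"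
  let ?B = "\<lambda>z. ?u (snd z) * cc z"
  have ac: "AE z in W \<Otimes>\<^sub>M T. p z = 0 \<longrightarrow> q (snd z) * cc z = 0"
    and A: "integrable (W \<Otimes>\<^sub>M T) ?A"
    and kl: "kl (W \<Otimes>\<^sub>M T) (joint q c) p = ereal (LINT z|(W \<Otimes>\<^sub>M T). ?A z)"
    using fin by (auto simp: kl_def joint_def case_prod_unfold split: if_splits)
  have ac_T: "AE t in T. m t = 0 \<longrightarrow> q t = 0"
    using ac by (rule AE_marginal_zero_imp)
  note ae = ac AE_pair_sndI[OF ac_T] AE_nonneg
  show nonneg: "AE z in W \<Otimes>\<^sub>M T. 0 \<le> defect z"
    using ae by eventually_elim (unfold defect_def, rule kl_chain_defect_nonneg(1), auto)
  show "AE z in W \<Otimes>\<^sub>M T. defect z = 0 \<longrightarrow> 0 < q (snd z) \<longrightarrow> cc z = p z / m (snd z)"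
    using ae
    by eventually_elim (unfold defect_def, intro impI, rule kl_chain_defect_nonneg(2), auto)
  \<comment> \<open>Where \<open>m t = 0\<close> the quotient is \<open>0\<close> by convention, so
    the identity there rests on \<open>q t = 0\<close>.\<close>
  have qm: "AE t in T. q t / m t * m t = q t"
    using ac_T by eventually_elim auto
  have qm_int: "integrable T (\<lambda>t. q t / m t * m t)" "(LINT t|T. q t / m t * m t) = 1"
  proof -
    show "integrable T (\<lambda>t. q t / m t * m t)"
      using qm prob_density_has_integral(1)[OF q]
      by (subst integrable_cong_AE[where g = q]) auto
    show "(LINT t|T. q t / m t * m t) = 1"
      using qm prob_density_has_integral(2)[OF q]
      by (subst integral_cong_AE[where g = q]) auto
  qed
  have C: "integrable (W \<Otimes>\<^sub>M T) (\<lambda>z. q (snd z) * cc z)"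
      "(LINT z|(W \<Otimes>\<^sub>M T). q (snd z) * cc z) = 1"
    using integrable_times_marginal_iff[OF times_c, of q] integral_times_marginal[OF times_c, of q]
      prob_density_has_integral[OF q] by auto
  have P: "integrable (W \<Otimes>\<^sub>M T) (\<lambda>z. q (snd z) / m (snd z) * p z)"
      "(LINT z|(W \<Otimes>\<^sub>M T). q (snd z) / m (snd z) * p z) = 1"
    using integrable_times_marginal_iff[OF times_p, of "\<lambda>t. q t / m t"]
      integral_times_marginal[OF times_p, of "\<lambda>t. q t / m t"] qm_int by auto
  have Mc: "integrable (W \<Otimes>\<^sub>M T) (\<lambda>z. m (snd z) * cc z)"
    using integrable_times_marginal_iff[OF times_c, of m] prob_density_has_integral(1)[OF m] by auto
  \<comment> \<open>\<open>?B\<close> is squeezed between integrable functions: above by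
    nonnegativity of the defect, below by \<open>(q - m) * c\<close>. The majorant collects the
    absolute values of both bounds.\<close>
  have B: "integrable (W \<Otimes>\<^sub>M T) ?B"
  proof (rule Bochner_Integration.integrable_bound)
    show "integrable (W \<Otimes>\<^sub>M T)
      (\<lambda>z. \<bar>?A z\<bar> + q (snd z) * cc z + q (snd z) / m (snd z) * p z + m (snd z) * cc z)"
      using A C(1) P(1) Mc by (intro Bochner_Integration.integrable_add integrable_abs)
    show "?B \<in> borel_measurable (W \<Otimes>\<^sub>M T)" by measurable
    show "AE z in W \<Otimes>\<^sub>M T. norm (?B z) \<le>
      norm (\<bar>?A z\<bar> + q (snd z) * cc z + q (snd z) / m (snd z) * p z + m (snd z) * cc z)"
      using nonneg ae
    proof eventually_elim
      case (elim z)
      \<comment> \<open>The pointwise inequality with its first and last arguments set to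
        \<open>1\<close> reads \<open>0 \<le> q * ln (q / m) - q + m\<close>.\<close>
      have "?u (snd z) \<ge> q (snd z) - m (snd z)"
        using kl_chain_defect_nonneg(1)[of 1 "q (snd z)" "m (snd z)" 1] elim by simp
      then have "?B z \<ge> (q (snd z) - m (snd z)) * cc z"
        using elim by (intro mult_right_mono) auto
      moreover have "?B z \<le> ?A z - q (snd z) * cc z + q (snd z) / m (snd z) * p z"
        using elim(1) by (simp add: defect_def algebra_simps)
      moreover have "0 \<le> q (snd z) * cc z" "0 \<le> m (snd z) * cc z" "0 \<le> q (snd z) / m (snd z) * p z"
        using elim by auto
      ultimately show ?case
        by (simp add: left_diff_distrib)
    qed
  qed
  have u: "integrable T ?u" "(LINT z|(W \<Otimes>\<^sub>M T). ?B z) = (LINT t|T. ?u t)"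
    using B integrable_times_marginal_iff[OF times_c, of ?u] integral_times_marginal[OF times_c, of ?u]
    by auto
  have defect: "defect = (\<lambda>z. ?A z - ?B z - q (snd z) * cc z + q (snd z) / m (snd z) * p z)"
    by (simp add: fun_eq_iff defect_def mult_ac)
  show "integrable (W \<Otimes>\<^sub>M T) defect"
    unfolding defect using A B C(1) P(1) by auto
  have "(LINT z|(W \<Otimes>\<^sub>M T). defect z) = (LINT z|(W \<Otimes>\<^sub>M T). ?A z) - (LINT t|T. ?u t)"
    unfolding defect using A B C P u(2) by simp
  moreover have "kl T q m = ereal (LINT t|T. ?u t)"
    using ac_T u(1) by (simp add: kl_def)
  ultimately show "kl (W \<Otimes>\<^sub>M T) (joint q c) p = kl T q m + ereal (LINT z|(W \<Otimes>\<^sub>M T). defect z)"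
    using kl by simp
qed

lemma kl_marginal_le_kl_joint: "kl T q m \<le> kl (W \<Otimes>\<^sub>M T) (joint q c) p"
proof (cases "kl (W \<Otimes>\<^sub>M T) (joint q c) p < \<infinity>")
  case True
  have "0 \<le> (LINT z|(W \<Otimes>\<^sub>M T). defect z)"
    using kl_joint_decomposition(2)[OF True] by (rule integral_nonneg_AE)
  then show ?thesis
    by (subst kl_joint_decomposition(4)[OF True]) (simp add: add_increasing2)
qed (auto simp: less_top[symmetric])

text \<open>Finiteness allows \<open>kl T q m\<close> to be cancelled from the decomposition. The
  nonnegative defect then has integral \<open>0\<close> and vanishes almost everywhere, which is the
  equality case of the pointwise bound.\<close>

lemma conditional_eq_of_kl_joint_eq:
  assumes eq: "kl (W \<Otimes>\<^sub>M T) (joint q c) p = kl T q m" and fin: "kl T q m < \<infinity>"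
  shows "AE z in W \<Otimes>\<^sub>M T. 0 < q (snd z) \<longrightarrow> 0 < m (snd z) \<and> cc z = p z / m (snd z)"
proof -
  note dec = kl_joint_decomposition[unfolded eq, OF fin]
  have ac_T: "AE t in T. m t = 0 \<longrightarrow> q t = 0" and "\<bar>kl T q m\<bar> \<noteq> \<infinity>"
    using fin by (auto simp: kl_def split: if_splits)
  then have "(LINT z|(W \<Otimes>\<^sub>M T). defect z) = 0"
    using dec(4) by (cases "kl T q m") auto
  then have "AE z in W \<Otimes>\<^sub>M T. defect z = 0"
    using dec(1,2) by (simp add: integral_nonneg_eq_0_iff_AE)
  then show ?thesis
    using dec(3) AE_pair_sndI[OF ac_T] AE_nonneg by eventually_elim force
qed

text \<open>When \<open>c = p / m\<close>, the ratio \<open>q * c / p\<close> reduces to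
  \<open>q / m\<close>, so the joint integrand is the marginal one times \<open>c\<close>, and
  \<open>c\<close> integrates out.\<close>

lemma kl_joint_eq_of_conditional:
  assumes cond: "AE z in W \<Otimes>\<^sub>M T. 0 < m (snd z) \<longrightarrow> cc z = p z / m (snd z)"
  shows "kl (W \<Otimes>\<^sub>M T) (joint q c) p = kl T q m"
proof (cases "kl T q m < \<infinity>")
  \<comment> \<open>An infinite marginal divergence forces the larger joint one to be
    infinite.\<close>
  case False
  then show ?thesis
    using kl_marginal_le_kl_joint by (simp add: less_top[symmetric] top_ereal_def)
next
  case True
  let ?u = "\<lambda>t. q t * ln (q t / m t)"
  have ac_T: "AE t in T. m t = 0 \<longrightarrow> q t = 0" and u: "integrable T ?u"
    and kl: "kl T q m = ereal (LINT t|T. ?u t)"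
    using True by (auto simp: kl_def split: if_splits)
  note ae = cond AE_pair_sndI[OF ac_T] AE_nonneg
  have ac: "AE z in W \<Otimes>\<^sub>M T. p z = 0 \<longrightarrow> q (snd z) * cc z = 0"
    using ae by eventually_elim (auto simp: less_le)
  have eq: "AE z in W \<Otimes>\<^sub>M T.
      q (snd z) * cc z * ln (q (snd z) * cc z / p z) = ?u (snd z) * cc z"
    using ae
  proof eventually_elim
    case (elim z)
    show ?case
    proof (cases "q (snd z) * cc z = 0")
      case False
      then have "cc z = p z / m (snd z)" "m (snd z) \<noteq> 0" "p z \<noteq> 0"
        using elim by (auto simp: less_le)
      then show ?thesis
        by simp
    qed auto
  qed
  have B: "integrable (W \<Otimes>\<^sub>M T) (\<lambda>z. ?u (snd z) * cc z)"
      "(LINT z|(W \<Otimes>\<^sub>M T). ?u (snd z) * cc z) = (LINT t|T. ?u t)"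
    using u integrable_times_marginal_iff[OF times_c, of ?u] integral_times_marginal[OF times_c, of ?u]
    by auto
  have "integrable (W \<Otimes>\<^sub>M T) (\<lambda>z. q (snd z) * cc z * ln (q (snd z) * cc z / p z))"
    using eq B(1) by (subst integrable_cong_AE[OF _ _ eq]) auto
  moreover have "(LINT z|(W \<Otimes>\<^sub>M T). q (snd z) * cc z * ln (q (snd z) * cc z / p z)) = (LINT t|T. ?u t)"
    using B(2) by (subst integral_cong_AE[OF _ _ eq]) auto
  ultimately show ?thesis
    unfolding kl using ac by (simp add: kl_def joint_def case_prod_unfold)
qed

end

section \<open>Optimality of the marginal and the augmented approximations\<close>

text \<open>The joint density does not see \<open>qA_cond\<close> where \<open>qA_marg\<close> is
  \<open>0\<close>, and if the optimal divergence is infinite, every member of the augmented family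
  is a minimizer; the claim on conditionals is restricted accordingly. Distinct minimizers over
  \<open>QM\<close> may tie, so the almost-everywhere equality of marginals is stated under
  essential uniqueness of the minimizer.\<close>

theorem proposition4:
  fixes T :: "'t measure" and W :: "'w measure" and n :: nat
    and prior :: "'t \<Rightarrow> real"
    and clik :: "nat \<Rightarrow> 'y \<Rightarrow> 'w \<Rightarrow> 't \<Rightarrow> real"
    and lik :: "nat \<Rightarrow> 'y \<Rightarrow> 't \<Rightarrow> real"
    and y :: "nat \<Rightarrow> 'y"
    and QM :: "('t \<Rightarrow> real) set"
    and QC :: "((nat \<Rightarrow> 'w) \<Rightarrow> 't \<Rightarrow> real) set"
    and qM qA_marg :: "'t \<Rightarrow> real"
    and qA_cond :: "(nat \<Rightarrow> 'w) \<Rightarrow> 't \<Rightarrow> real"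
  defines "WT \<equiv> latent_space n W \<Otimes>\<^sub>M T"
    and "post \<equiv> posterior T n prior lik y"
    and "aug \<equiv> aug_posterior T W n prior clik y"
  assumes "sigma_finite_measure T" and "sigma_finite_measure W"
    and "prior \<in> borel_measurable T" and "\<And>t. t \<in> space T \<Longrightarrow> 0 \<le> prior t"
    and "\<And>i. i \<in> {1..n} \<Longrightarrow> (\<lambda>(w, t). clik i (y i) w t) \<in> borel_measurable (W \<Otimes>\<^sub>M T)"
    and "\<And>i w t. i \<in> {1..n} \<Longrightarrow> w \<in> space W \<Longrightarrow> t \<in> space T \<Longrightarrow> 0 \<le> clik i (y i) w t"
    and "\<And>i t. i \<in> {1..n} \<Longrightarrow> t \<in> space T \<Longrightarrow>
           has_bochner_integral W (\<lambda>w. clik i (y i) w t) (lik i (y i) t)"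
    and "integrable T (\<lambda>t. prior t * (\<Prod>i=1..n. lik i (y i) t))"
    and "0 < (LINT t|T. prior t * (\<Prod>i=1..n. lik i (y i) t))"
    and "\<And>q. q \<in> QM \<Longrightarrow> prob_density T q"
    and "\<And>c. c \<in> QC \<Longrightarrow> cond_prob_density (latent_space n W) T c"
    and "is_kl_minimizer T QM post qM"
    and "qA_marg \<in> QM" and "qA_cond \<in> QC"
    and "is_kl_minimizer WT (aug_family QM QC) aug (joint qA_marg qA_cond)"
  shows "kl T qM post \<le> kl T qA_marg post
    \<and> kl T qA_marg post \<le> kl WT (joint qA_marg qA_cond) aug
    \<and> (\<forall>post_cond. is_conditional_of (latent_space n W) T aug post_cond \<and> post_cond \<in> QC \<longrightarrow>
         (kl T qM post < \<infinity> \<longrightarrow>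
            (AE (w, t) in WT. 0 < qA_marg t \<longrightarrow> qA_cond w t = post_cond w t))
       \<and> ((\<forall>q. is_kl_minimizer T QM post q \<longrightarrow> (AE t in T. q t = qM t)) \<longrightarrow>
            (AE t in T. qA_marg t = qM t))
       \<and> kl T qM post = kl T qA_marg post
       \<and> kl T qA_marg post = kl WT (joint qA_marg qA_cond) aug)"
proof -
  let ?L = "latent_space n W"
  interpret T: sigma_finite_measure T by fact
  interpret W: sigma_finite_measure W by fact
  interpret P: product_sigma_finite "\<lambda>_::nat. W" ..
  interpret L: sigma_finite_measure ?L by (rule P.sigma_finite) simp
  interpret LT: pair_sigma_finite ?L T ..
  note prior[measurable] = assms(6) and prior_nonneg = assms(7)
  note clik_measurable = assms(8) and clik_nonneg = assms(9) and lik = assms(10)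
  note evidence = assms(11) assms(12)
  note QM = assms(13) and QC = assms(14) and qM = assms(15) and qA = assms(16-18)

  \<comment> \<open>The unnormalized posteriors and their marginal relation\<close>
  define g where "g = (\<lambda>t. prior t * (\<Prod>i=1..n. lik i (y i) t))"
  define G where "G = (\<lambda>(w, t). prior t * (\<Prod>i=1..n. clik i (y i) (w i) t))"
  have post_eq: "post = normalized T g" and aug_eq: "aug = normalized WT G"
    by (simp_all add: post_def aug_def WT_def posterior_def aug_posterior_def g_def G_def)
  have g: "integrable T g" "0 < (LINT t|T. g t)"
    using evidence by (simp_all add: g_def)
  have lik_nonneg: "0 \<le> lik i (y i) t" if "i \<in> {1..n}" "t \<in> space T" for i t
    using has_bochner_integral_integral_eq[OF lik[OF that]] clik_nonneg that
    by (metis Bochner_Integration.integral_nonneg)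
  have g_nonneg: "0 \<le> g t" if "t \<in> space T" for t
    using that by (auto simp: g_def intro!: mult_nonneg_nonneg prod_nonneg prior_nonneg lik_nonneg)
  have G_measurable [measurable]: "G \<in> borel_measurable (?L \<Otimes>\<^sub>M T)"
  proof -
    have "(\<lambda>z. clik i (y i) (fst z i) (snd z)) \<in> borel_measurable (?L \<Otimes>\<^sub>M T)" if "i \<in> {1..n}" for i
    proof -
      have "(\<lambda>z. (fst z i, snd z)) \<in> ?L \<Otimes>\<^sub>M T \<rightarrow>\<^sub>M W \<Otimes>\<^sub>M T"
        using that by (intro measurable_Pair measurable_compose[OF measurable_fst]) auto
      from measurable_compose[OF this clik_measurable[OF that]] show ?thesis
        by simp
    qed
    then show ?thesis
      unfolding G_def case_prod_unfold by (intro borel_measurable_times borel_measurable_prod) auto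
  qed
  have G_nonneg: "0 \<le> G z" if "z \<in> space (?L \<Otimes>\<^sub>M T)" for z
    using that
    by (auto simp: G_def space_pair_measure space_PiM PiE_iff
        intro!: mult_nonneg_nonneg prod_nonneg prior_nonneg clik_nonneg)
  \<comment> \<open>The \<open>i\<close>-th factor depends on \<open>w\<close> only through
    \<open>w i\<close>, so the integral over the product space factors. It is taken in
    \<open>ennreal\<close> because integrability of \<open>G\<close> is only derived from this
    identity.\<close>
  have marginal_G: "(\<integral>\<^sup>+w. ennreal (G (w, t)) \<partial>?L) = ennreal (g t)" if t: "t \<in> space T" for t
  proof -
    have clik_t: "(\<lambda>w. clik i (y i) w t) \<in> borel_measurable W" if "i \<in> {1..n}" for i
      using lik[OF that t] by (auto simp: has_bochner_integral_iff)
    have clik_prod: "(\<lambda>w. \<Prod>i=1..n. ennreal (clik i (y i) (w i) t)) \<in> borel_measurable ?L"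
    proof (intro borel_measurable_prod_ennreal)
      fix i assume i: "i \<in> {1..n}"
      have "(\<lambda>w. clik i (y i) (w i) t) \<in> borel_measurable ?L"
        using measurable_component_singleton[OF i, of "\<lambda>_. W"] clik_t[OF i]
        by (rule measurable_compose)
      then show "(\<lambda>w. ennreal (clik i (y i) (w i) t)) \<in> borel_measurable ?L"
        by measurable
    qed
    have "(\<integral>\<^sup>+w. ennreal (G (w, t)) \<partial>?L) =
        (\<integral>\<^sup>+w. ennreal (prior t) * (\<Prod>i=1..n. ennreal (clik i (y i) (w i) t)) \<partial>?L)"
    proof (intro nn_integral_cong)
      fix w assume "w \<in> space ?L"
      then have pos: "0 \<le> clik i (y i) (w i) t" if "i \<in> {1..n}" for i
        using that t by (intro clik_nonneg) (auto simp: space_PiM)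
      then have "ennreal (G (w, t)) = ennreal (prior t) * ennreal (\<Prod>i=1..n. clik i (y i) (w i) t)"
        unfolding G_def prod.case by (intro ennreal_mult prior_nonneg prod_nonneg pos t)
      then show "ennreal (G (w, t)) = ennreal (prior t) * (\<Prod>i=1..n. ennreal (clik i (y i) (w i) t))"
        using pos by (simp only: prod_ennreal)
    qed
    also have "\<dots> = ennreal (prior t) * (\<integral>\<^sup>+w. (\<Prod>i=1..n. ennreal (clik i (y i) (w i) t)) \<partial>?L)"
      using clik_prod by (rule nn_integral_cmult)
    also have "(\<integral>\<^sup>+w. (\<Prod>i=1..n. ennreal (clik i (y i) (w i) t)) \<partial>?L) =
        (\<Prod>i=1..n. \<integral>\<^sup>+w. ennreal (clik i (y i) w t) \<partial>W)"
      using clik_t by (intro P.product_nn_integral_prod) auto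
    also have "\<dots> = (\<Prod>i=1..n. ennreal (lik i (y i) t))"
    proof (intro prod.cong refl)
      fix i assume i: "i \<in> {1..n}"
      have "integrable W (\<lambda>w. clik i (y i) w t)" "(LINT w|W. clik i (y i) w t) = lik i (y i) t"
        using lik[OF i t] by (auto simp: has_bochner_integral_iff)
      then show "(\<integral>\<^sup>+w. ennreal (clik i (y i) w t) \<partial>W) = ennreal (lik i (y i) t)"
        using clik_nonneg[OF i _ t] by (subst nn_integral_eq_integral) auto
    qed
    also have "\<dots> = ennreal (\<Prod>i=1..n. lik i (y i) t)"
      by (intro prod_ennreal lik_nonneg t)
    also have "ennreal (prior t) * \<dots> = ennreal (g t)"
      unfolding g_def by (intro ennreal_mult[symmetric] prior_nonneg prod_nonneg lik_nonneg t)
    finally show ?thesis .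
  qed

  \<comment> \<open>Normalization and the marginal of the augmented posterior\<close>
  have evidence_G: "integrable (?L \<Otimes>\<^sub>M T) G" "(LINT z|(?L \<Otimes>\<^sub>M T). G z) = (LINT t|T. g t)"
    using LT.integrable_times_marginal_iff[OF G_measurable _ _ G_nonneg g_nonneg marginal_G, of "\<lambda>_. 1"]
      LT.integral_times_marginal[OF G_measurable _ _ G_nonneg g_nonneg marginal_G, of "\<lambda>_. 1"] g
    by auto
  have post: "prob_density T post"
    unfolding post_eq using g g_nonneg by (intro prob_density_normalized)
  have aug: "prob_density (?L \<Otimes>\<^sub>M T) aug"
    unfolding aug_eq WT_def using evidence_G g G_nonneg by (intro prob_density_normalized) auto
  \<comment> \<open>By \<open>evidence_G\<close> both posteriors are divided by the same constant,
    so the marginal relation survives normalization.\<close>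
  have marginal_aug: "(\<integral>\<^sup>+w. ennreal (aug (w, t)) \<partial>?L) = ennreal (post t)" if t: "t \<in> space T" for t
  proof -
    have "(\<integral>\<^sup>+w. ennreal (aug (w, t)) \<partial>?L) =
        (\<integral>\<^sup>+w. ennreal (G (w, t)) * ennreal (inverse (LINT t|T. g t)) \<partial>?L)"
      using t g(2) G_nonneg evidence_G(2)
      by (intro nn_integral_cong)
        (simp add: aug_eq WT_def normalized_def divide_inverse ennreal_mult space_pair_measure)
    also have "\<dots> = ennreal (g t) * ennreal (inverse (LINT t|T. g t))"
      using t by (subst nn_integral_multc) (auto simp: marginal_G simp del: One_nat_def)
    also have "\<dots> = ennreal (post t)"
      using t g(2) g_nonneg by (simp add: post_eq normalized_def divide_inverse ennreal_mult)
    finally show ?thesis .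
  qed
  have KL: "kl_disintegration ?L T aug post q c" if "q \<in> QM" "c \<in> QC" for q c
    using aug post marginal_aug QM[OF that(1)] QC[OF that(2)]
    by unfold_locales (auto simp: prob_density_def)
  interpret A: kl_disintegration ?L T aug post qA_marg qA_cond
    using qA by (intro KL)

  \<comment> \<open>The two inequalities and the case of an available exact conditional\<close>
  have "qM \<in> QM" and qM_le: "kl T qM post \<le> kl T q post" if "q \<in> QM" for q
    using qM that by (auto simp: is_arg_min_linorder)
  then have qM_in: "qM \<in> QM" and le1: "kl T qM post \<le> kl T qA_marg post"
    using qA(1) by auto
  have le2: "kl T qA_marg post \<le> kl WT (joint qA_marg qA_cond) aug"
    unfolding WT_def by (rule A.kl_marginal_le_kl_joint)
  have exact: "(kl T qM post < \<infinity> \<longrightarrow>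
            (AE (w, t) in WT. 0 < qA_marg t \<longrightarrow> qA_cond w t = pc w t))
       \<and> ((\<forall>q. is_kl_minimizer T QM post q \<longrightarrow> (AE t in T. q t = qM t)) \<longrightarrow>
            (AE t in T. qA_marg t = qM t))
       \<and> kl T qM post = kl T qA_marg post
       \<and> kl T qA_marg post = kl WT (joint qA_marg qA_cond) aug"
    if pc: "is_conditional_of ?L T aug pc" "pc \<in> QC" for pc
  proof -
    interpret B: kl_disintegration ?L T aug post qM pc
      using qM_in pc(2) by (rule KL)
    \<comment> \<open>This turns the quotient in \<open>is_conditional_of\<close> into
      \<open>aug / post\<close>.\<close>
    have "marginal ?L aug t = post t" if "t \<in> space T" for t
      using that unfolding marginal_def
      by (subst integral_eq_nn_integral)
        (auto simp: marginal_aug A.m_nonneg space_pair_measure simp del: One_nat_def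
          intro!: AE_I2 A.p_nonneg)
    then have cond: "AE z in ?L \<Otimes>\<^sub>M T. 0 < post (snd z) \<longrightarrow> pc (fst z) (snd z) = aug z / post (snd z)"
      using pc(1) AE_space unfolding is_conditional_of_def
      by (auto simp: case_prod_unfold space_pair_measure elim: eventually_elim2)
    \<comment> \<open>Joint minimality against this pair bounds the largest term of the chain by its
      smallest.\<close>
    have "kl WT (joint qA_marg qA_cond) aug \<le> kl WT (joint qM pc) aug"
      using qA(3) qM_in pc(2) by (auto simp: is_arg_min_linorder aug_family_def)
    also have "\<dots> = kl T qM post"
      unfolding WT_def using cond by (rule B.kl_joint_eq_of_conditional)
    finally have eq: "kl T qM post = kl T qA_marg post"
        "kl T qA_marg post = kl WT (joint qA_marg qA_cond) aug"
      using le1 le2 by auto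
    have "AE (w, t) in WT. 0 < qA_marg t \<longrightarrow> qA_cond w t = pc w t" if "kl T qM post < \<infinity>"
    proof -
      have "AE z in ?L \<Otimes>\<^sub>M T. 0 < qA_marg (snd z) \<longrightarrow>
          0 < post (snd z) \<and> qA_cond (fst z) (snd z) = aug z / post (snd z)"
        using eq that by (intro A.conditional_eq_of_kl_joint_eq) (auto simp: WT_def)
      then show ?thesis
        unfolding WT_def case_prod_unfold using cond by eventually_elim simp
    qed
    \<comment> \<open>Having attained the optimal value, \<open>qA_marg\<close> is itself a
      minimizer over \<open>QM\<close>, so the uniqueness assumption applies to it.\<close>
    moreover have "is_kl_minimizer T QM post qA_marg"
      using qA(1) qM_le eq(1) by (simp add: is_arg_min_linorder)
    ultimately show ?thesis
      using eq by blast
  qed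
  show ?thesis
    using le1 le2 exact by blast
qed

end
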